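(* Let $X$ be a topological space, let $\mathcal A$ be a collection of subsets of $X$, and let $\mathcal B$ be the closure of $\mathcal A$ under finite unions. Then the games $G_1(\mathcal N_{\mathcal A},\neg\mathcal O)$ and $G_1(\mathcal N_{\mathcal B},\neg\mathcal O)$ on $X$ are equivalent.
   Context: Let $\mathcal T$ be the topology of $X$. The closure of $\mathcal A$ under finite unions is the smallest collection containing $\mathcal A$ and closed under unions of nonempty finite subcollections. For $A\subseteq X$ let $B_A=\{U\in\mathcal T: A\subseteq U\}$, and for a collection $\mathcal A$ of subsets of $X$ let $\mathcal N_{\mathcal A}=\{B_A: A\in\mathcal A\}$. The game $G_1(\mathcal N_{\mathcal A},\neg\mathcal O)$: in each round $n<\omega$, ONE chooses some $B_{A_n}\in\mathcal N_{\mathcal A}$, and then TWO chooses an open set $V_n\in B_{A_n}$. TWO wins if $\{V_n:n<\omega\}$ fails to cover $X$; ONE wins otherwise. Strategies. A (perfect-information) strategy for a player chooses each move as a function of the finite sequence of all the opponent's moves made so far; $P\uparrow G$ means player $P$ has a strategy in $G$ that wins against every play of the opponent. A Markov strategy chooses each move as a function only of the most recent move of the opponent and the current round number; $P\uparrow_{\mathrm{mark}}G$ means $P$ has a winning Markov strategy. A predetermined strategy chooses each move as a function only of the current round number; $P\uparrow_{\mathrm{pre}}G$ means $P$ has a winning predetermined strategy. Two games $G,H$ with players ONE and TWO are equivalent if all four of the following hold: $ONE\uparrow G$ iff $ONE\uparrow H$; $TWO\uparrow G$ iff $TWO\uparrow H$; $ONE\uparrow_{\mathrm{pre}}G$ iff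 $ONE\uparrow_{\mathrm{pre}}H$; $TWO\uparrow_{\mathrm{mark}}G$ iff $TWO\uparrow_{\mathrm{mark}}H$. *)

theory Defs
  imports "HOL-Analysis.Abstract_Topology"
begin

text \<open>\<open>G1 S W\<close> is the selection game in which, in each round, ONE chooses some \<open>F \<in> S\<close> and
  TWO responds with some \<open>x \<in> F\<close>; TWO wins iff the set of all of TWO's choices belongs to \<open>W\<close>.\<close>

datatype 'b game = G1 (choices: "'b set set") (target: "'b set set")

text \<open>Histories are lists in chronological order. A strategy for ONE is applied to the list of
  TWO's \<open>n\<close> moves before round \<open>n\<close>, a strategy for TWO to the list of ONE's \<open>n + 1\<close> moves
  up to and including round \<open>n\<close>.\<close>

definition strategy_ONE :: "'b game \<Rightarrow> ('b list \<Rightarrow> 'b set) \<Rightarrow> bool" where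
  "strategy_ONE G \<sigma> \<longleftrightarrow> (\<forall>h \<in> lists (\<Union> (choices G)). \<sigma> h \<in> choices G)"

definition strategy_TWO :: "'b game \<Rightarrow> ('b set list \<Rightarrow> 'b) \<Rightarrow> bool" where
  "strategy_TWO G \<tau> \<longleftrightarrow> (\<forall>h \<in> lists (choices G). h \<noteq> [] \<longrightarrow> \<tau> h \<in> last h)"

definition ONE_wins :: "'b game \<Rightarrow> bool" where
  "ONE_wins G \<longleftrightarrow> (\<exists>\<sigma>. strategy_ONE G \<sigma> \<and>
     (\<forall>x. (\<forall>n. x n \<in> \<sigma> (map x [0..<n])) \<longrightarrow> range x \<notin> target G))"

definition TWO_wins :: "'b game \<Rightarrow> bool" where
  "TWO_wins G \<longleftrightarrow> (\<exists>\<tau>. strategy_TWO G \<tau> \<and>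
     (\<forall>F. (\<forall>n. F n \<in> choices G) \<longrightarrow> range (\<lambda>n. \<tau> (map F [0..<Suc n])) \<in> target G))"

definition ONE_wins_pre :: "'b game \<Rightarrow> bool" where
  "ONE_wins_pre G \<longleftrightarrow> (\<exists>\<sigma> :: nat \<Rightarrow> 'b set. (\<forall>n. \<sigma> n \<in> choices G) \<and>
     (\<forall>x. (\<forall>n. x n \<in> \<sigma> n) \<longrightarrow> range x \<notin> target G))"

definition TWO_wins_mark :: "'b game \<Rightarrow> bool" where
  "TWO_wins_mark G \<longleftrightarrow> (\<exists>\<tau> :: 'b set \<Rightarrow> nat \<Rightarrow> 'b. (\<forall>F \<in> choices G. \<forall>n. \<tau> F n \<in> F) \<and>
     (\<forall>F. (\<forall>n. F n \<in> choices G) \<longrightarrow> range (\<lambda>n. \<tau> (F n) n) \<in> target G))"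

definition equivalent_games :: "'b game \<Rightarrow> 'c game \<Rightarrow> bool" where
  "equivalent_games G H \<longleftrightarrow>
     (ONE_wins G \<longleftrightarrow> ONE_wins H) \<and>
     (TWO_wins G \<longleftrightarrow> TWO_wins H) \<and>
     (ONE_wins_pre G \<longleftrightarrow> ONE_wins_pre H) \<and>
     (TWO_wins_mark G \<longleftrightarrow> TWO_wins_mark H)"

definition open_supersets :: "'a topology \<Rightarrow> 'a set \<Rightarrow> 'a set set" where
  "open_supersets X A = {U. openin X U \<and> A \<subseteq> U}"

definition nbhd_family :: "'a topology \<Rightarrow> 'a set set \<Rightarrow> 'a set set set" where
  "nbhd_family X \<A> = open_supersets X ` \<A>"

definition open_noncovers :: "'a topology \<Rightarrow> 'a set set set" where
  "open_noncovers X = {\<V>. (\<forall>V\<in>\<V>. openin X V) \<and> \<not> topspace X \<subseteq> \<Union>\<V>}"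

definition finite_union_closure :: "'a set set \<Rightarrow> 'a set set" where
  "finite_union_closure \<A> =
     (\<lambda>\<C>. \<forall>\<F>. finite \<F> \<and> \<F> \<noteq> {} \<and> \<F> \<subseteq> \<C> \<longrightarrow> \<Union>\<F> \<in> \<C>) hull \<A>"

end

theory Submission
  imports Defs "HOL-Library.Nat_Bijection"
begin

text \<open>
  An open set contains \<open>A\<^sub>1 \<union> \<dots> \<union> A\<^sub>k\<close> iff it contains each \<open>A\<^sub>i\<close>, so the move
  \<open>A\<^sub>1 \<union> \<dots> \<union> A\<^sub>k\<close> of ONE is the intersection of the moves \<open>A\<^sub>1, \<dots>, A\<^sub>k\<close>. The point is
  that one round with this move can be traded for \<open>k\<close> rounds with the moves \<open>A\<^sub>i\<close>: if TWO
  answers these with \<open>V\<^sub>1, \<dots>, V\<^sub>k\<close>, then \<open>V\<^sub>1 \<union> \<dots> \<union> V\<^sub>k\<close> is a legal answer to the single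
  round. The winning condition depends only on the union of all answers, so the trade does not
  affect who wins.

  Finite unions only add moves for ONE: a winning strategy of ONE survives this, and a winning
  strategy of TWO against the larger family of moves also wins against the smaller one. For the
  other directions the rounds are traded:
  \<^item> Strategies that see the round number but not the history need no scheduling: the
    \<open>j\<close>-th sub-round of round \<open>n\<close> takes place in the round that codes the pair \<open>(n, j)\<close>. To
    fill all codes, the finite list of sub-moves is extended to an infinite sequence with
    repetitions (\<open>ONE_wins_pre_coarse\<close>, \<open>TWO_wins_mark_fine\<close>).
  \<^item> With perfect information the sub-rounds are played in blocks one after the other. TWO
    expands the history of ONE's moves by concatenation (\<open>TWO_wins_fine\<close>). For ONE, the length
    of a block depends on what TWO has answered so far, and the history has to be parsed into
    blocks recursively (\<open>next_move\<close>, \<open>next_move_blocks\<close>, \<open>ONE_wins_coarse\<close>).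
\<close>

section \<open>Finite unions and their neighbourhood families\<close>

lemma open_noncovers_mono:
  assumes "\<V> \<in> open_noncovers X" "\<And>U. U \<in> \<U> \<Longrightarrow> openin X U" "\<Union>\<U> \<subseteq> \<Union>\<V>"
  shows "\<U> \<in> open_noncovers X"
  using assms unfolding open_noncovers_def by blast

text \<open>The unions of nonempty finite subfamilies already form a closed collection: finitely many
  of them together use only finitely many members of \<open>\<A>\<close>.\<close>

lemma finite_union_closure_cases:
  assumes "B \<in> finite_union_closure \<A>"
  obtains \<F> where "finite \<F>" "\<F> \<noteq> {}" "\<F> \<subseteq> \<A>" "B = \<Union>\<F>"
proof -
  let ?I = "{\<F>. finite \<F> \<and> \<F> \<noteq> {} \<and> \<F> \<subseteq> \<A>}"
  have "finite_union_closure \<A> \<subseteq> Union ` ?I"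
    unfolding finite_union_closure_def
  proof (rule hull_minimal)
    show "\<A> \<subseteq> Union ` ?I"
    proof
      fix A assume "A \<in> \<A>"
      then have "{A} \<in> ?I" by simp
      moreover have "A = \<Union>{A}" by simp
      ultimately show "A \<in> Union ` ?I" by (rule rev_image_eqI)
    qed
    show "\<forall>\<G>. finite \<G> \<and> \<G> \<noteq> {} \<and> \<G> \<subseteq> Union ` ?I \<longrightarrow> \<Union>\<G> \<in> Union ` ?I"
    proof (intro allI impI)
      fix \<G> assume \<G>: "finite \<G> \<and> \<G> \<noteq> {} \<and> \<G> \<subseteq> Union ` ?I"
      then obtain \<H> where \<H>: "\<H> \<subseteq> ?I" "finite \<H>" "\<G> = Union ` \<H>"
        using finite_subset_image[of \<G> Union ?I] by blast
      have "finite (\<Union>\<H>)" using \<H>(1,2) by (intro finite_Union) auto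
      moreover have "\<Union>\<H> \<subseteq> \<A>" using \<H>(1) by blast
      moreover have "\<Union>\<H> \<noteq> {}"
      proof -
        obtain \<F> where "\<F> \<in> \<H>" using \<G> \<H>(3) by blast
        then show ?thesis using \<H>(1) by blast
      qed
      ultimately have "\<Union>\<H> \<in> ?I" by simp
      moreover have "\<Union>\<G> = \<Union>(\<Union>\<H>)" unfolding \<H>(3) by auto
      ultimately show "\<Union>\<G> \<in> Union ` ?I" by (rule rev_image_eqI)
    qed
  qed
  then have "B \<in> Union ` ?I" using assms by (rule subsetD)
  then obtain \<F> where "\<F> \<in> ?I" "B = \<Union>\<F>" by (rule imageE)
  then show thesis using that[of \<F>] by simp
qed

lemma open_supersets_Union:
  assumes "\<F> \<noteq> {}"
  shows "open_supersets X (\<Union>\<F>) = \<Inter>(open_supersets X ` \<F>)"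
  using assms unfolding open_supersets_def by blast

lemma nbhd_family_finite_union_closure:
  assumes "F \<in> nbhd_family X (finite_union_closure \<A>)"
  shows "\<exists>l. l \<noteq> [] \<and> set l \<subseteq> nbhd_family X \<A> \<and> F = \<Inter>(set l)"
proof -
  obtain B where B: "F = open_supersets X B" "B \<in> finite_union_closure \<A>"
    using assms unfolding nbhd_family_def by (rule imageE)
  obtain \<F> where \<F>: "finite \<F>" "\<F> \<noteq> {}" "\<F> \<subseteq> \<A>" "B = \<Union>\<F>"
    using B(2) by (rule finite_union_closure_cases)
  obtain l where l: "set l = open_supersets X ` \<F>"
    using finite_list[OF finite_imageI[OF \<F>(1)]] by (rule exE)
  have "set l \<noteq> {}" unfolding l using \<F>(2) by simp
  then have "l \<noteq> []" by simp
  moreover have "set l \<subseteq> nbhd_family X \<A>"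
    unfolding l nbhd_family_def using \<F>(3) by (rule image_mono)
  moreover have "F = \<Inter>(set l)"
    unfolding l B(1) \<F>(4) using \<F>(2) by (rule open_supersets_Union)
  ultimately show ?thesis by blast
qed

section \<open>Trading a round for several rounds\<close>

text \<open>The game sees the sets whose neighbourhoods ONE plays only through the families of their
  neighbourhoods, and of these families only openness, upward closure and the relation between
  the two games matter. \<open>fine\<close> stands for the family that belongs to the finite unions:
  it contains intersections of coarse moves, which leave TWO fewer answers.\<close>

locale finite_intersections =
  fixes X :: "'a topology" and coarse fine :: "'a set set set"
  assumes coarse_subset: "coarse \<subseteq> fine"
    and openin_coarse: "\<And>F U. F \<in> coarse \<Longrightarrow> U \<in> F \<Longrightarrow> openin X U"
    and coarse_upward: "\<And>F U V. F \<in> coarse \<Longrightarrow> U \<in> F \<Longrightarrow> openin X V \<Longrightarrow> U \<subseteq> V \<Longrightarrow> V \<in> F"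
    and fine_Inter: "\<And>F. F \<in> fine \<Longrightarrow> \<exists>l. l \<noteq> [] \<and> set l \<subseteq> coarse \<and> F = \<Inter>(set l)"
begin

definition factors :: "'a set set \<Rightarrow> 'a set set list" where
  "factors F = (SOME l. l \<noteq> [] \<and> set l \<subseteq> coarse \<and> F = \<Inter>(set l))"

lemma factors:
  assumes "F \<in> fine"
  shows "factors F \<noteq> []" "set (factors F) \<subseteq> coarse" "F = \<Inter>(set (factors F))"
  using someI_ex[OF fine_Inter[OF assms]] unfolding factors_def by blast+

lemma Union_fine: "\<Union>fine = \<Union>coarse"
proof
  show "\<Union>coarse \<subseteq> \<Union>fine" using coarse_subset by blast
  show "\<Union>fine \<subseteq> \<Union>coarse"
  proof
    fix U assume "U \<in> \<Union>fine"
    then obtain F where F: "F \<in> fine" "U \<in> F" by blast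
    have "hd (factors F) \<in> set (factors F)" using factors(1)[OF F(1)] by simp
    then show "U \<in> \<Union>coarse" using factors(2,3)[OF F(1)] F(2) by blast
  qed
qed

lemma openin_Union_coarse: "U \<in> \<Union>coarse \<Longrightarrow> openin X U"
  using openin_coarse by blast

lemma openin_fine: "F \<in> fine \<Longrightarrow> U \<in> F \<Longrightarrow> openin X U"
  using openin_Union_coarse Union_fine by blast

text \<open>This is the trade: answers to all factors of a move combine to an answer to the move.
  Since \<open>\<U>\<close> may contain further open sets, repeated factors and answers to other rounds
  do no harm.\<close>

lemma Union_in_fine:
  assumes "F \<in> fine" "\<And>U. U \<in> \<U> \<Longrightarrow> openin X U"
    and "\<And>G. G \<in> set (factors F) \<Longrightarrow> \<exists>U\<in>\<U>. U \<in> G"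
  shows "\<Union>\<U> \<in> F"
proof -
  have "\<Union>\<U> \<in> G" if G: "G \<in> set (factors F)" for G
  proof -
    obtain U where U: "U \<in> \<U>" "U \<in> G" using assms(3)[OF G] by blast
    moreover have "openin X (\<Union>\<U>)" using assms(2) by blast
    ultimately show ?thesis
      using coarse_upward[of G U "\<Union>\<U>"] factors(2)[OF assms(1)] G by blast
  qed
  then show ?thesis using factors(3)[OF assms(1)] by blast
qed

subsection \<open>Reusing strategies\<close>

text \<open>Every move of ONE in the coarse game is also one in the fine game. The histories to which a
  strategy of ONE has to react are the same in both games because \<open>\<Union>fine = \<Union>coarse\<close>.\<close>

lemma ONE_wins_fine:
  assumes "ONE_wins (G1 coarse W)" shows "ONE_wins (G1 fine W)"
proof -
  obtain \<sigma> where *: "(\<forall>h \<in> lists (\<Union>coarse). \<sigma> h \<in> coarse) \<and>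
      (\<forall>x. (\<forall>n. x n \<in> \<sigma> (map x [0..<n])) \<longrightarrow> range x \<notin> W)"
    using assms unfolding ONE_wins_def strategy_ONE_def game.sel by (rule exE)
  note \<sigma> = *[THEN conjunct1] and win = *[THEN conjunct2]
  have "\<forall>h \<in> lists (\<Union>fine). \<sigma> h \<in> fine"
    using \<sigma> coarse_subset unfolding Union_fine by (blast dest: bspec)
  then show ?thesis
    unfolding ONE_wins_def strategy_ONE_def game.sel using win by (intro exI[of _ \<sigma>] conjI)
qed

lemma ONE_wins_pre_fine:
  assumes "ONE_wins_pre (G1 coarse W)" shows "ONE_wins_pre (G1 fine W)"
proof -
  obtain \<sigma> :: "nat \<Rightarrow> _" where *: "(\<forall>n. \<sigma> n \<in> coarse) \<and>
      (\<forall>x. (\<forall>n. x n \<in> \<sigma> n) \<longrightarrow> range x \<notin> W)"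
    using assms unfolding ONE_wins_pre_def game.sel by (rule exE)
  note \<sigma> = *[THEN conjunct1] and win = *[THEN conjunct2]
  have "\<forall>n. \<sigma> n \<in> fine" using \<sigma> coarse_subset by (blast dest: spec)
  then show ?thesis
    unfolding ONE_wins_pre_def game.sel using win by (intro exI[of _ \<sigma>] conjI)
qed

lemma TWO_wins_coarse:
  assumes "TWO_wins (G1 fine W)" shows "TWO_wins (G1 coarse W)"
proof -
  obtain \<tau> where *: "(\<forall>h \<in> lists fine. h \<noteq> [] \<longrightarrow> \<tau> h \<in> last h) \<and>
      (\<forall>F. (\<forall>n. F n \<in> fine) \<longrightarrow> range (\<lambda>n. \<tau> (map F [0..<Suc n])) \<in> W)"
    using assms unfolding TWO_wins_def strategy_TWO_def game.sel by (rule exE)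
  note \<tau> = *[THEN conjunct1] and win = *[THEN conjunct2]
  have "\<forall>h \<in> lists coarse. h \<noteq> [] \<longrightarrow> \<tau> h \<in> last h"
    using \<tau> lists_mono[OF coarse_subset] by (meson subsetD)
  moreover have "\<forall>F. (\<forall>n. F n \<in> coarse) \<longrightarrow> range (\<lambda>n. \<tau> (map F [0..<Suc n])) \<in> W"
    using win coarse_subset by (meson subsetD)
  ultimately show ?thesis
    unfolding TWO_wins_def strategy_TWO_def game.sel by (intro exI[of _ \<tau>] conjI)
qed

lemma TWO_wins_mark_coarse:
  assumes "TWO_wins_mark (G1 fine W)" shows "TWO_wins_mark (G1 coarse W)"
proof -
  obtain \<tau> :: "_ \<Rightarrow> nat \<Rightarrow> _" where *: "(\<forall>F \<in> fine. \<forall>n. \<tau> F n \<in> F) \<and>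
      (\<forall>F. (\<forall>n. F n \<in> fine) \<longrightarrow> range (\<lambda>n. \<tau> (F n) n) \<in> W)"
    using assms unfolding TWO_wins_mark_def game.sel by (rule exE)
  note \<tau> = *[THEN conjunct1] and win = *[THEN conjunct2]
  have "\<forall>F \<in> coarse. \<forall>n. \<tau> F n \<in> F"
    using \<tau> coarse_subset by (meson subsetD)
  moreover have "\<forall>F. (\<forall>n. F n \<in> coarse) \<longrightarrow> range (\<lambda>n. \<tau> (F n) n) \<in> W"
    using win coarse_subset by (meson subsetD)
  ultimately show ?thesis
    unfolding TWO_wins_mark_def game.sel by (intro exI[of _ \<tau>] conjI)
qed

subsection \<open>Strategies that know the round number\<close>

definition factor_seq :: "'a set set \<Rightarrow> nat \<Rightarrow> 'a set set" where
  "factor_seq F j = factors F ! (j mod length (factors F))"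

lemma range_factor_seq:
  assumes "F \<in> fine"
  shows "range (factor_seq F) = set (factors F)"
proof
  show "range (factor_seq F) \<subseteq> set (factors F)"
    using factors(1)[OF assms] by (auto simp: factor_seq_def)
  show "set (factors F) \<subseteq> range (factor_seq F)"
  proof
    fix G assume "G \<in> set (factors F)"
    then obtain j where "j < length (factors F)" "G = factors F ! j"
      by (metis in_set_conv_nth)
    then have "G = factor_seq F j" by (simp add: factor_seq_def)
    then show "G \<in> range (factor_seq F)" by blast
  qed
qed

lemma factor_seq_in_coarse: "F \<in> fine \<Longrightarrow> factor_seq F j \<in> coarse"
  using range_factor_seq factors(2) by blast

lemma ONE_wins_pre_coarse:
  assumes "ONE_wins_pre (G1 fine (open_noncovers X))"
  shows "ONE_wins_pre (G1 coarse (open_noncovers X))"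
proof -
  obtain \<sigma> :: "nat \<Rightarrow> _" where *: "(\<forall>n. \<sigma> n \<in> fine) \<and>
      (\<forall>x. (\<forall>n. x n \<in> \<sigma> n) \<longrightarrow> range x \<notin> open_noncovers X)"
    using assms unfolding ONE_wins_pre_def game.sel by (rule exE)
  note \<sigma> = *[THEN conjunct1, rule_format] and win = *[THEN conjunct2, rule_format]
  define \<rho> where "\<rho> i = (case prod_decode i of (n, j) \<Rightarrow> factor_seq (\<sigma> n) j)" for i
  have \<rho>_code: "\<rho> (prod_encode (n, j)) = factor_seq (\<sigma> n) j" for n j
    by (simp add: \<rho>_def)
  have \<rho>: "\<rho> i \<in> coarse" for i
    using factor_seq_in_coarse[OF \<sigma>] by (simp add: \<rho>_def split: prod.split)
  have "range x \<notin> open_noncovers X" if x: "\<And>i. x i \<in> \<rho> i" for x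
  proof
    assume lost: "range x \<in> open_noncovers X"
    have opn: "openin X (x i)" for i using openin_coarse \<rho> x by blast
    define y where "y n = (\<Union>j. x (prod_encode (n, j)))" for n
    have "y n \<in> \<sigma> n" for n
      unfolding y_def
    proof (rule Union_in_fine[OF \<sigma>])
      fix G assume "G \<in> set (factors (\<sigma> n))"
      then obtain j where "G = factor_seq (\<sigma> n) j" using range_factor_seq[OF \<sigma>] by blast
      then show "\<exists>U \<in> range (\<lambda>j. x (prod_encode (n, j))). U \<in> G" using x \<rho>_code by blast
    qed (use opn in blast)
    then have "range y \<notin> open_noncovers X" by (rule win)
    moreover have "range y \<in> open_noncovers X"
      using lost by (rule open_noncovers_mono) (auto simp: y_def opn)
    ultimately show False by blast
  qed
  then show ?thesis
    unfolding ONE_wins_pre_def game.sel using \<rho> by (intro exI[of _ \<rho>]) simp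
qed

lemma TWO_wins_mark_fine:
  assumes "TWO_wins_mark (G1 coarse (open_noncovers X))"
  shows "TWO_wins_mark (G1 fine (open_noncovers X))"
proof -
  obtain \<tau> :: "_ \<Rightarrow> nat \<Rightarrow> _" where *: "(\<forall>F \<in> coarse. \<forall>n. \<tau> F n \<in> F) \<and>
      (\<forall>F. (\<forall>n. F n \<in> coarse) \<longrightarrow> range (\<lambda>n. \<tau> (F n) n) \<in> open_noncovers X)"
    using assms unfolding TWO_wins_mark_def game.sel by (rule exE)
  note \<tau> = *[THEN conjunct1, rule_format] and win = *[THEN conjunct2, rule_format]
  define \<rho> where "\<rho> F n = (\<Union>j. \<tau> (factor_seq F j) (prod_encode (n, j)))" for F n
  have \<rho>: "\<rho> F n \<in> F" if F: "F \<in> fine" for F n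
    unfolding \<rho>_def
  proof (rule Union_in_fine[OF F])
    fix G assume "G \<in> set (factors F)"
    then obtain j where "G = factor_seq F j" using range_factor_seq[OF F] by blast
    then show "\<exists>U \<in> range (\<lambda>j. \<tau> (factor_seq F j) (prod_encode (n, j))). U \<in> G"
      using \<tau> factor_seq_in_coarse[OF F] by blast
  qed (use openin_coarse \<tau> factor_seq_in_coarse[OF F] in blast)
  have "range (\<lambda>n. \<rho> (F n) n) \<in> open_noncovers X" if F: "\<And>n. F n \<in> fine" for F
  proof -
    define G where "G i = (case prod_decode i of (n, j) \<Rightarrow> factor_seq (F n) j)" for i
    have "G i \<in> coarse" for i using factor_seq_in_coarse F by (auto simp: G_def split: prod.split)
    then have "range (\<lambda>i. \<tau> (G i) i) \<in> open_noncovers X" by (rule win)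
    then show ?thesis
    proof (rule open_noncovers_mono)
      show "\<Union>(range (\<lambda>n. \<rho> (F n) n)) \<subseteq> \<Union>(range (\<lambda>i. \<tau> (G i) i))"
      proof
        fix p assume "p \<in> \<Union>(range (\<lambda>n. \<rho> (F n) n))"
        then obtain n j where "p \<in> \<tau> (factor_seq (F n) j) (prod_encode (n, j))"
          by (auto simp: \<rho>_def)
        then have "p \<in> \<tau> (G (prod_encode (n, j))) (prod_encode (n, j))" by (simp add: G_def)
        then show "p \<in> \<Union>(range (\<lambda>i. \<tau> (G i) i))" by blast
      qed
    qed (use openin_fine \<rho> F in blast)
  qed
  then show ?thesis
    unfolding TWO_wins_mark_def game.sel using \<rho> by (intro exI[of _ \<rho>]) simp
qed

end

subsection \<open>Perfect information for TWO\<close>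

text \<open>The concatenation of infinitely many nonempty lists, as a sequence. It is well defined
  because the concatenation of the first \<open>n\<close> lists has at least \<open>n\<close> entries.\<close>

lemma concat_nonempty_lists_seq:
  assumes "\<And>i. L i \<noteq> []"
  obtains f where "\<And>n. n \<le> length (concat (map L [0..<n]))"
    and "\<And>n j. j \<le> length (concat (map L [0..<n])) \<Longrightarrow>
    take j (concat (map L [0..<n])) = map f [0..<j]"
proof -
  define C where "C n = concat (map L [0..<n])" for n
  define f where "f i = C (Suc i) ! i" for i
  have C_Suc: "C (Suc n) = C n @ L n" for n by (simp add: C_def)
  have len: "n \<le> length (C n)" for n
  proof (induction n)
    case (Suc n)
    have "0 < length (L n)" using assms by simp
    then show ?case using Suc unfolding C_Suc length_append by linarith
  qed simp
  have stable: "C (n + d) ! i = C n ! i" if "i < length (C n)" for n d i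
  proof (induction d)
    case (Suc d)
    have "length (C n) \<le> length (C (n + d))" by (induction d) (auto simp: C_Suc)
    with that have "i < length (C (n + d))" by linarith
    then show ?case using Suc by (simp add: C_Suc nth_append)
  qed simp
  have "C n ! i = f i" if "i < length (C n)" for n i
  proof -
    have "i < length (C (Suc i))" using len[of "Suc i"] by linarith
    then have "C (Suc i + n) ! i = f i" unfolding f_def by (rule stable)
    moreover have "C (n + Suc i) ! i = C n ! i" using that by (rule stable)
    ultimately show ?thesis by (simp add: add.commute)
  qed
  then have "take j (C n) = map f [0..<j]" if "j \<le> length (C n)" for n j
    using that by (intro nth_equalityI) auto
  with len show thesis using that unfolding C_def by blast
qed

context finite_intersections
begin

lemma TWO_wins_fine:
  assumes "TWO_wins (G1 coarse (open_noncovers X))"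
  shows "TWO_wins (G1 fine (open_noncovers X))"
proof -
  obtain \<tau> where *: "(\<forall>h \<in> lists coarse. h \<noteq> [] \<longrightarrow> \<tau> h \<in> last h) \<and>
      (\<forall>F. (\<forall>n. F n \<in> coarse) \<longrightarrow> range (\<lambda>n. \<tau> (map F [0..<Suc n])) \<in> open_noncovers X)"
    using assms unfolding TWO_wins_def strategy_TWO_def game.sel by (rule exE)
  note \<tau> = *[THEN conjunct1, rule_format] and win = *[THEN conjunct2, rule_format]
  define flat where "flat h = concat (map factors h)" for h
  \<comment> \<open>The answers to earlier rounds are included again: this changes neither legality nor the
    total union, and it spares locating the last block within the flattened history.\<close>
  define \<rho> where "\<rho> h = (\<Union>j\<in>{..<length (flat h)}. \<tau> (take (Suc j) (flat h)))" for h
  have legal: "\<rho> h \<in> last h" if h: "h \<in> lists fine" "h \<noteq> []" for h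
  proof -
    have F: "last h \<in> fine" using h by auto
    have flat: "flat h \<in> lists coarse" using h(1) factors(2) by (fastforce simp: flat_def)
    have pre: "\<tau> (take (Suc j) (flat h)) \<in> flat h ! j" if "j < length (flat h)" for j
    proof -
      have "take (Suc j) (flat h) \<in> lists coarse"
        using flat by (auto dest: in_set_takeD)
      moreover have "last (take (Suc j) (flat h)) = flat h ! j"
        using that by (simp add: take_Suc_conv_app_nth)
      moreover have "take (Suc j) (flat h) \<noteq> []" using that by auto
      ultimately show ?thesis using \<tau> by metis
    qed
    show ?thesis
      unfolding \<rho>_def
    proof (rule Union_in_fine[OF F])
      fix U assume "U \<in> (\<lambda>j. \<tau> (take (Suc j) (flat h))) ` {..<length (flat h)}"
      then obtain j where "j < length (flat h)" "U \<in> flat h ! j" using pre by blast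
      moreover from this have "flat h ! j \<in> coarse" using flat by (metis in_lists_conv_set nth_mem)
      ultimately show "openin X U" using openin_coarse by blast
    next
      fix G assume G: "G \<in> set (factors (last h))"
      have "set (factors (last h)) \<subseteq> set (flat h)"
        using last_in_set[OF h(2)] by (auto simp: flat_def)
      then obtain j where "j < length (flat h)" "G = flat h ! j"
        using G by (metis in_set_conv_nth subsetD)
      then show "\<exists>U \<in> (\<lambda>j. \<tau> (take (Suc j) (flat h))) ` {..<length (flat h)}. U \<in> G"
        using pre by blast
    qed
  qed
  have "range (\<lambda>n. \<rho> (map F [0..<Suc n])) \<in> open_noncovers X" if F: "\<And>n. F n \<in> fine" for F
  proof -
    have nonempty: "factors (F i) \<noteq> []" for i using factors(1) F by blast
    obtain f where len: "\<And>n. n \<le> length (flat (map F [0..<n]))"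
      and f: "\<And>n j. j \<le> length (flat (map F [0..<n])) \<Longrightarrow>
        take j (flat (map F [0..<n])) = map f [0..<j]"
      using concat_nonempty_lists_seq[of "\<lambda>i. factors (F i)"] nonempty
      unfolding flat_def map_map comp_def by blast
    have "f i \<in> coarse" for i
    proof -
      have "take (Suc i) (flat (map F [0..<Suc i])) = map f [0..<Suc i]" by (rule f[OF len])
      moreover have "f i \<in> set (map f [0..<Suc i])" by simp
      ultimately have "f i \<in> set (flat (map F [0..<Suc i]))" by (metis in_set_takeD)
      then show ?thesis using factors(2) F by (fastforce simp: flat_def)
    qed
    then have "range (\<lambda>n. \<tau> (map f [0..<Suc n])) \<in> open_noncovers X" by (rule win)
    then show ?thesis
    proof (rule open_noncovers_mono)
      show "\<Union>(range (\<lambda>n. \<rho> (map F [0..<Suc n]))) \<subseteq> \<Union>(range (\<lambda>n. \<tau> (map f [0..<Suc n])))"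
      proof
        fix p assume "p \<in> \<Union>(range (\<lambda>n. \<rho> (map F [0..<Suc n])))"
        then obtain n j where "j < length (flat (map F [0..<Suc n]))"
            "p \<in> \<tau> (take (Suc j) (flat (map F [0..<Suc n])))"
          unfolding \<rho>_def by blast
        then have "p \<in> \<tau> (map f [0..<Suc j])" using f[of "Suc j" "Suc n"] by simp
        then show "p \<in> \<Union>(range (\<lambda>n. \<tau> (map f [0..<Suc n])))" by blast
      qed
    next
      fix U assume "U \<in> range (\<lambda>n. \<rho> (map F [0..<Suc n]))"
      then obtain n where n: "U = \<rho> (map F [0..<Suc n])" by blast
      have "\<rho> (map F [0..<Suc n]) \<in> last (map F [0..<Suc n])" using F by (intro legal) auto
      then have "U \<in> F n" using n by simp
      then show "openin X U" using openin_fine F by blast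
    qed
  qed
  then show ?thesis
    unfolding TWO_wins_def strategy_TWO_def game.sel using legal
    by (intro exI[of _ \<rho>]) (simp del: upt_Suc)
qed

end

subsection \<open>Perfect information for ONE\<close>

text \<open>The next sub-move of ONE when the blocks completed so far have been condensed to the
  history \<open>h\<close> and \<open>xs\<close> are the answers of TWO since then; \<open>D h\<close> lists the sub-moves of the
  block that follows \<open>h\<close>. The test for \<open>[]\<close> only ensures termination.\<close>

function next_move :: "('a set list \<Rightarrow> 'b list) \<Rightarrow> 'a set list \<Rightarrow> 'a set list \<Rightarrow> 'b" where
  "next_move D h xs =
    (if D h = [] then undefined
     else if length xs < length (D h) then D h ! length xs
     else next_move D (h @ [\<Union>(set (take (length (D h)) xs))]) (drop (length (D h)) xs))"
  by pat_completeness auto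
termination
proof (relation "measure (\<lambda>(D, h, xs). length xs)")
  fix D :: "'a set list \<Rightarrow> 'b list" and h xs :: "'a set list"
  assume "D h \<noteq> []" "\<not> length xs < length (D h)"
  then have "0 < length (D h)" "length (D h) \<le> length xs" by simp_all
  then have "length (drop (length (D h)) xs) < length xs" unfolding length_drop by linarith
  then show "((D, h @ [\<Union>(set (take (length (D h)) xs))], drop (length (D h)) xs), D, h, xs)
      \<in> measure (\<lambda>(D, h, xs). length xs)"
    by simp
qed simp

declare next_move.simps [simp del]

lemma next_move_in:
  assumes "\<And>h. h \<in> lists \<V> \<Longrightarrow> D h \<noteq> [] \<and> set (D h) \<subseteq> S"
    and "\<And>l. l \<in> lists \<V> \<Longrightarrow> l \<noteq> [] \<Longrightarrow> \<Union>(set l) \<in> \<V>"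
    and "h \<in> lists \<V>" "xs \<in> lists \<V>"
  shows "next_move D h xs \<in> S"
  using assms
proof (induction D h xs rule: next_move.induct)
  case (1 D h xs)
  have D: "D h \<noteq> []" "set (D h) \<subseteq> S" using 1(2,4) by blast+
  show ?case
  proof (cases "length xs < length (D h)")
    case True
    then have "D h ! length xs \<in> S" using D(2) nth_mem by blast
    then show ?thesis using True D(1) by (simp add: next_move.simps[of D h])
  next
    case False
    have take: "take (length (D h)) xs \<in> lists \<V>" and drop: "drop (length (D h)) xs \<in> lists \<V>"
      using 1(5) by (auto dest: in_set_takeD in_set_dropD)
    have "take (length (D h)) xs \<noteq> []" using False D(1) by auto
    then have "h @ [\<Union>(set (take (length (D h)) xs))] \<in> lists \<V>"
      using 1(3)[OF take] 1(4) by simp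
    then have "next_move D (h @ [\<Union>(set (take (length (D h)) xs))]) (drop (length (D h)) xs) \<in> S"
      using 1(1)[OF D(1) False] 1(2,3) drop by blast
    then show ?thesis using False D(1) by (simp add: next_move.simps[of D h])
  qed
qed

text \<open>Every play \<open>x\<close> splits into blocks. The \<open>k\<close>-th block begins in round \<open>n k\<close>, and the union of
  its answers is \<open>y k\<close>, the answer in the condensed play.\<close>

lemma next_move_blocks:
  fixes x :: "nat \<Rightarrow> 'a set"
  assumes nonempty: "\<And>h. set h \<subseteq> \<V> \<Longrightarrow> D h \<noteq> []"
    and closed: "\<And>l. l \<in> lists \<V> \<Longrightarrow> l \<noteq> [] \<Longrightarrow> \<Union>(set l) \<in> \<V>"
    and x: "\<And>i. x i \<in> \<V>"
  obtains n y where
    "\<And>k. y k = (\<Union>i\<in>{..<length (D (map y [0..<k]))}. x (n k + i))"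
    "\<And>k. y k \<in> \<V>"
    "\<And>k i. i < length (D (map y [0..<k])) \<Longrightarrow>
       next_move D [] (map x [0..<n k + i]) = D (map y [0..<k]) ! i"
proof -
  define block where "block s = (\<Union>i\<in>{..<length (D (snd s))}. x (fst s + i))" for s
  define st where
    "st = rec_nat (0, []) (\<lambda>_ s. (fst s + length (D (snd s)), snd s @ [block s]))"
  define n where "n k = fst (st k)" for k
  define y where "y k = block (st k)" for k
  have hist: "snd (st k) = map y [0..<k]" for k
    by (induction k) (simp_all add: st_def y_def)
  have n0: "n 0 = 0" and n_Suc: "n (Suc k) = n k + length (D (map y [0..<k]))" for k
    using hist[of k] by (simp_all add: n_def st_def)
  have y: "y k = (\<Union>i\<in>{..<length (D (map y [0..<k]))}. x (n k + i))" for k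
    using hist[of k] by (simp add: y_def block_def n_def)
  have y_set: "y k = \<Union>(set (map x [n k..<n (Suc k)]))" for k
  proof -
    have "{n k..<n (Suc k)} = (\<lambda>i. n k + i) ` {..<length (D (map y [0..<k]))}"
      by (simp add: n_Suc lessThan_atLeast0 add.commute)
    then show ?thesis unfolding y[of k] by (simp add: image_image)
  qed
  have y_in: "y k \<in> \<V>" for k
  proof (induction k rule: less_induct)
    case (less k)
    then have "D (map y [0..<k]) \<noteq> []" by (intro nonempty) auto
    then have "map x [n k..<n (Suc k)] \<noteq> []" by (simp add: n_Suc)
    moreover have "map x [n k..<n (Suc k)] \<in> lists \<V>" using x by auto
    ultimately show ?case unfolding y_set using closed by blast
  qed
  have D: "D (map y [0..<k]) \<noteq> []" for k using y_in by (intro nonempty) auto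
  have parse: "next_move D [] (map x [0..<m]) = next_move D (map y [0..<k]) (map x [n k..<m])"
    if "n k \<le> m" for k m
    using that
  proof (induction k)
    case 0
    then show ?case by (simp add: n0)
  next
    case (Suc k)
    let ?d = "length (D (map y [0..<k]))"
    have le: "n k + ?d \<le> m" using Suc.prems by (simp add: n_Suc)
    have "take ?d (map x [n k..<m]) = map x [n k..<n (Suc k)]"
      using le by (simp add: take_map n_Suc)
    moreover have "drop ?d (map x [n k..<m]) = map x [n (Suc k)..<m]"
      by (simp add: drop_map n_Suc)
    moreover have "\<not> length (map x [n k..<m]) < ?d" using le by simp
    ultimately have "next_move D (map y [0..<k]) (map x [n k..<m]) =
        next_move D (map y [0..<k] @ [y k]) (map x [n (Suc k)..<m])"
      using D[of k] unfolding next_move.simps[of D "map y [0..<k]"] y_set[of k] by simp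
    then show ?case using Suc.IH le by simp
  qed
  have "next_move D [] (map x [0..<n k + i]) = D (map y [0..<k]) ! i"
    if "i < length (D (map y [0..<k]))" for k i
    using that D[of k] by (simp add: parse[of k] next_move.simps[of D "map y [0..<k]"])
  then show thesis using that y y_in by blast
qed

context finite_intersections
begin

lemma ONE_wins_coarse:
  assumes "ONE_wins (G1 fine (open_noncovers X))"
  shows "ONE_wins (G1 coarse (open_noncovers X))"
proof -
  let ?\<V> = "\<Union>coarse"
  obtain \<sigma> where *: "(\<forall>h \<in> lists (\<Union>coarse). \<sigma> h \<in> fine) \<and>
      (\<forall>x. (\<forall>n. x n \<in> \<sigma> (map x [0..<n])) \<longrightarrow> range x \<notin> open_noncovers X)"
    using assms unfolding ONE_wins_def strategy_ONE_def game.sel Union_fine by (rule exE)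
  note \<sigma> = *[THEN conjunct1, rule_format] and win = *[THEN conjunct2, rule_format]
  define D where "D h = factors (\<sigma> h)" for h
  have D: "D h \<noteq> [] \<and> set (D h) \<subseteq> coarse" if "h \<in> lists ?\<V>" for h
    using factors \<sigma>[OF that] by (simp add: D_def)
  \<comment> \<open>A strategy has to make legal moves even after histories that it cannot produce, where
    the union of a block need not answer the move simulated by the block. It still is
    an answer to some move of ONE.\<close>
  have closed: "\<Union>(set l) \<in> ?\<V>" if l: "l \<in> lists ?\<V>" "l \<noteq> []" for l
  proof -
    obtain F where F: "F \<in> coarse" "hd l \<in> F" using l hd_in_set by blast
    have "openin X (\<Union>(set l))" using l(1) openin_Union_coarse by blast
    moreover have "hd l \<subseteq> \<Union>(set l)" using l(2) hd_in_set by blast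
    ultimately show ?thesis using coarse_upward F by blast
  qed
  have legal: "next_move D [] h \<in> coarse" if "h \<in> lists ?\<V>" for h
    using D closed that by (intro next_move_in) auto
  have "range x \<notin> open_noncovers X" if x: "\<And>i. x i \<in> next_move D [] (map x [0..<i])" for x
  proof
    assume lost: "range x \<in> open_noncovers X"
    have x_in: "x i \<in> ?\<V>" for i
    proof (induction i rule: less_induct)
      case (less i)
      then have "map x [0..<i] \<in> lists ?\<V>" by auto
      then show ?case using legal x by blast
    qed
    have nonempty: "D h \<noteq> []" if "set h \<subseteq> ?\<V>" for h using D that by auto
    obtain n y where y: "\<And>k. y k = (\<Union>i\<in>{..<length (D (map y [0..<k]))}. x (n k + i))"
      and y_in: "\<And>k. y k \<in> ?\<V>"
      and moves: "\<And>k i. i < length (D (map y [0..<k])) \<Longrightarrow>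
        next_move D [] (map x [0..<n k + i]) = D (map y [0..<k]) ! i"
      using next_move_blocks[of ?\<V> D x] nonempty closed x_in by metis
    have "y k \<in> \<sigma> (map y [0..<k])" for k
      unfolding y[of k]
    proof (rule Union_in_fine)
      show "\<sigma> (map y [0..<k]) \<in> fine" using y_in by (intro \<sigma>) auto
    next
      fix G assume "G \<in> set (factors (\<sigma> (map y [0..<k])))"
      then obtain i where i: "i < length (D (map y [0..<k]))" "G = D (map y [0..<k]) ! i"
        unfolding D_def by (metis in_set_conv_nth)
      then have "x (n k + i) \<in> G" using x[of "n k + i"] moves by simp
      then show "\<exists>U \<in> (\<lambda>i. x (n k + i)) ` {..<length (D (map y [0..<k]))}. U \<in> G"
        using i(1) by blast
    qed (use openin_Union_coarse x_in in blast)
    then have "range y \<notin> open_noncovers X" by (rule win)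
    moreover have "range y \<in> open_noncovers X"
      using lost
    proof (rule open_noncovers_mono)
      show "\<Union>(range y) \<subseteq> \<Union>(range x)" using y by blast
    qed (use openin_Union_coarse y_in in blast)
    ultimately show False by blast
  qed
  then show ?thesis
    unfolding ONE_wins_def strategy_ONE_def game.sel using legal
    by (intro exI[of _ "next_move D []"]) simp
qed

theorem equivalent_games_finite_intersections:
  "equivalent_games (G1 coarse (open_noncovers X)) (G1 fine (open_noncovers X))"
  unfolding equivalent_games_def
  using ONE_wins_fine ONE_wins_coarse TWO_wins_fine TWO_wins_coarse
    ONE_wins_pre_fine ONE_wins_pre_coarse TWO_wins_mark_fine TWO_wins_mark_coarse by blast

end

section \<open>Equivalence of the two games\<close>

theorem lemma4p1:
  fixes X :: "'a topology" and \<A> \<B> :: "'a set set"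
  assumes "\<A> \<subseteq> Pow (topspace X)"
    and "\<B> = finite_union_closure \<A>"
  shows "equivalent_games (G1 (nbhd_family X \<A>) (open_noncovers X))
                          (G1 (nbhd_family X \<B>) (open_noncovers X))"
proof -
  interpret finite_intersections X "nbhd_family X \<A>" "nbhd_family X \<B>"
  proof
    show "nbhd_family X \<A> \<subseteq> nbhd_family X \<B>"
      unfolding nbhd_family_def assms(2) finite_union_closure_def
      by (rule image_mono, rule hull_subset)
    show "\<exists>l. l \<noteq> [] \<and> set l \<subseteq> nbhd_family X \<A> \<and> F = \<Inter>(set l)"
      if "F \<in> nbhd_family X \<B>" for F
      using that unfolding assms(2) by (rule nbhd_family_finite_union_closure)
    show "openin X U" if "F \<in> nbhd_family X \<A>" "U \<in> F" for F U
      using that by (auto simp: nbhd_family_def open_supersets_def)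
    show "V \<in> F" if "F \<in> nbhd_family X \<A>" "U \<in> F" "openin X V" "U \<subseteq> V" for F U V
      using that by (auto simp: nbhd_family_def open_supersets_def)
  qed
  show ?thesis by (rule equivalent_games_finite_intersections)
qed

end
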